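(* Let $U$ be a smooth $\mathbb{R}^n$-valued function on $\overline\Omega$ (at a fixed time), and let $\tilde A$, $T$, $\Lambda$, $\Lambda^{\pm}$, $W=T^{-1}U$, $W^{\pm}$, $I^-$ be as in the context, so that the boundary term satisfies $$\oint_{\partial\Omega}U^T(n_iA_i)U\,ds=\oint_{\partial\Omega}U^T\tilde A\,U\,ds=\oint_{\partial\Omega}W^T\Lambda W\,ds .$$ Consider the boundary condition $$\sqrt{|\Lambda^-|}\,W^-=R\sqrt{\Lambda^+}\,W^++SG\qquad\text{on }\partial\Omega, \tag{BC}$$ where $R$ and $S$ are matrices ($S$ non-singular) and $G$ is given boundary data. All matrix inequalities below are required at every point of $\partial\Omega$. 1. (Strong homogeneous boundary conditions.) Suppose (BC) holds with $G=0$ and $$I-R^TR\ge 0. \tag{a}$$ Then $\oint_{\partial\Omega}W^T\Lambda W\,ds\ge 0$. 2. (Strong inhomogeneous boundary conditions.) Suppose (BC) holds with data $G$, that (a) holds with strict inequality, i.e. $I-R^TR>0$, and that $$I-S^TS-(R^TS)^T(I-R^TR)^{-1}(R^TS)\ge 0,\qquad\text{where } (I-R^TR)^{-1}=\sum_{k=0}^{\infty}(R^TR)^k. \tag{b}$$ Then $\oint_{\partial\Omega}W^T\Lambda W\,ds\ge-\oint_{\partial\Omega}G^TG\,ds$. 3. (Weak homogeneous boundary conditions.) Suppose (a) holds and the penalty matrix is $$\Sigma=\sqrt{|\Lambda^-|}. \tag{c}$$ Then, without assuming that $U$ satisfies (BC), the boundary term augmented with the weak (lifting) contribution for $G=0$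 satisfies $$\oint_{\partial\Omega}\Big(W^T\Lambda W+2\,U^T(I^-T^{-1})^T\Sigma\big(\sqrt{|\Lambda^-|}\,W^--R\sqrt{\Lambda^+}\,W^+\big)\Big)ds\ge 0 .$$ 4. (Weak inhomogeneous boundary conditions.) Suppose (a) holds with strict inequality, (b) holds, and $\Sigma$ is given by (c). Then, without assuming that $U$ satisfies (BC), the boundary term augmented with the weak (lifting) contribution satisfies $$\oint_{\partial\Omega}\Big(W^T\Lambda W+2\,U^T(I^-T^{-1})^T\Sigma\big(\sqrt{|\Lambda^-|}\,W^--R\sqrt{\Lambda^+}\,W^+-SG\big)\Big)ds\ge-\oint_{\partial\Omega}G^TG\,ds .$$
   Context: $\Omega\subset\mathbb{R}^k$ is a domain with boundary $\partial\Omega$, outward unit normal $(n_1,\dots,n_k)$ and surface measure $ds$. Repeated indices are summed (Einstein convention). The matrices $A_i=A_i(V)$, $i=1,\dots,k$, are real $n\times n$ matrices depending smoothly on an $n$-vector function $V$; in the nonlinear case $V=U$, in the linear case $V$ is a given function. They are the coefficients of the initial boundary value problem $PU_t+(A_i(V)U)_{x_i}+A_i^T(V)U_{x_i}+C(V)U=0$ in $\Omega$; applying the energy method (multiplication by $U^T$ and integration over $\Omega$) produces the boundary term $\oint_{\partial\Omega}U^T(n_iA_i)U\,ds$. $\tilde A=\tfrac12\big((n_iA_i)+(n_iA_i)^T\big)$ is the symmetric part of $n_iA_i$. At each boundary point a non-singular real matrix $T$ (possibly depending on the solution) is given with $T^T\tilde A\,T=\Lambda=\mathrm{diag}(\lambda_1,\dots,\lambda_n)$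 (the $\lambda_i$ need not be eigenvalues of $\tilde A$). The transformed variables are $W=T^{-1}U$. Notation for positive and negative parts, at each boundary point: $W^-\in\mathbb{R}^{m_-}$ collects the components $W_i$ of $W$ with $\lambda_i<0$ and $W^+\in\mathbb{R}^{m_+}$ collects the remaining components, $m_-+m_+=n$; $\Lambda^-$ and $\Lambda^+$ are the corresponding diagonal matrices of the negative and of the remaining (non-negative) $\lambda_i$, so that $W^T\Lambda W=(W^+)^T\Lambda^+W^++(W^-)^T\Lambda^-W^-$. $I^-$ is the indicator (selection) matrix with $I^-W=W^-$. For a diagonal matrix, $|\mathrm{diag}(\lambda_i)|=\mathrm{diag}(|\lambda_i|)$, and $\sqrt{\mathrm{diag}(\mu_i)}=\mathrm{diag}(\sqrt{\mu_i})$ for $\mu_i\ge0$. The matrix $R$ has size $m_-\times m_+$, $S$ is a non-singular $m_-\times m_-$ matrix, $G$ takes values in $\mathbb{R}^{m_-}$, and $\Sigma$ is $m_-\times m_-$; $R$ and $S$ may depend on the boundary point and on the solution. For a symmetric matrix $X$, $X\ge0$ means positive semi-definite and $X>0$ positive definite. "Strong" imposition means that (BC) holds exactly on $\partial\Omega$. "Weak" imposition means that the term $L_C(U)=L_C\big(2(I^-T^{-1})^T\Sigma(\sqrt{|\Lambda^-|}W^--R\sqrt{\Lambda^+}W^+-SG)\big)$ is added to the left-hand side of the differential equation, where the lifting operator $L_C$ is defined by $\int_\Omega\phi^TL_C(\psi)\,d\Omega=\oint_{\partial\Omega}\phi^T\psi\,ds$ for smooth vector functions $\phi,\psi$; after applying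 the energy method this adds the corresponding integral to the boundary term. *)

theory Defs
  imports "HOL-Analysis.Analysis" "Jordan_Normal_Form.Gauss_Jordan_Elimination"
begin

unbundle no vec_syntax and no inner_syntax

section \<open>Smooth functions, surface measure, outward normal\<close>

fun Ck_on :: "nat \<Rightarrow> ('a::euclidean_space \<Rightarrow> 'b::real_normed_vector) \<Rightarrow> 'a set \<Rightarrow> bool" where
  "Ck_on 0 f S = continuous_on S f"
| "Ck_on (Suc m) f S =
     ((\<forall>x\<in>S. f differentiable (at x)) \<and>
      (\<forall>b\<in>Basis. Ck_on m (\<lambda>x. frechet_derivative f (at x) b) S))"

text \<open>Smoothness on a set that need not be open (such as \<open>closure \<Omega>\<close>) means agreement with a
  \<open>C\<^sup>\<infinity>\<close> function on an open neighbourhood.\<close>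

definition smooth_on :: "('a::euclidean_space \<Rightarrow> 'b::real_normed_vector) \<Rightarrow> 'a set \<Rightarrow> bool" where
  "smooth_on f S \<longleftrightarrow>
     (\<exists>N g. open N \<and> S \<subseteq> N \<and> (\<forall>m. Ck_on m g N) \<and> (\<forall>x\<in>S. f x = g x))"

text \<open>Hausdorff measure of dimension \<open>d\<close>, normalised by the volume \<open>unit_ball_vol d\<close> of the unit
  ball so that for \<open>d = DIM('a) - 1\<close> it is the usual surface measure. Empty covering sets are
  treated separately because \<open>0 ^ 0 = 1\<close>, which is what makes \<open>d = 0\<close> the counting measure.
  The outer measure is a metric outer measure, hence countably additive on the Borel sets, so
  that \<open>measure_of\<close> does not degenerate to the zero measure.\<close>

definition hausdorff_pre :: "nat \<Rightarrow> real \<Rightarrow> 'a::euclidean_space set \<Rightarrow> ennreal" where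
  "hausdorff_pre d \<delta> E =
     (INF C \<in> {C :: nat \<Rightarrow> 'a set. E \<subseteq> (\<Union>i. C i) \<and> (\<forall>i. bounded (C i) \<and> diameter (C i) \<le> \<delta>)}.
        \<Sum>i. if C i = {} then 0 else ennreal (unit_ball_vol (real d) * (diameter (C i) / 2) ^ d))"

definition hausdorff_outer :: "nat \<Rightarrow> 'a::euclidean_space set \<Rightarrow> ennreal" where
  "hausdorff_outer d E = (SUP \<delta> \<in> {0<..}. hausdorff_pre d \<delta> E)"

definition hausdorff_measure :: "nat \<Rightarrow> 'a::euclidean_space measure" where
  "hausdorff_measure d = measure_of UNIV (sets borel) (hausdorff_outer d)"

definition surface_measure :: "'a::euclidean_space measure" where
  "surface_measure = hausdorff_measure (DIM('a) - 1)"

definition boundary_integral :: "'a::euclidean_space set \<Rightarrow> ('a \<Rightarrow> real) \<Rightarrow> real" where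
  "boundary_integral \<Omega> f = (LINT x:frontier \<Omega>|surface_measure. f x)"

text \<open>Near \<open>x\<close> the set is a sublevel set of a \<open>C\<^sup>1\<close> function \<open>\<rho>\<close> with nonzero gradient,
  and \<open>\<nu>\<close> is the normalised gradient.\<close>

definition outward_unit_normal :: "'a::euclidean_space set \<Rightarrow> 'a \<Rightarrow> 'a \<Rightarrow> bool" where
  "outward_unit_normal \<Omega> x \<nu> \<longleftrightarrow>
     (\<exists>N \<rho> g. open N \<and> x \<in> N \<and> Ck_on 1 \<rho> N \<and>
        \<Omega> \<inter> N = {y \<in> N. \<rho> y < 0} \<and> frontier \<Omega> \<inter> N = {y \<in> N. \<rho> y = 0} \<and>
        GDERIV \<rho> x :> g \<and> g \<noteq> 0 \<and> \<nu> = g /\<^sub>R norm g)"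

section \<open>Matrices\<close>

text \<open>The sizes of \<open>W\<^sup>-\<close>, \<open>W\<^sup>+\<close>, \<open>R\<close>, \<open>S\<close> vary with the boundary point, so the linear algebra
  on the boundary uses matrices with explicit dimensions. The two functions below transfer
  vectors and square matrices, listing the index type in increasing order.\<close>

definition coord :: "nat \<Rightarrow> 'n::{finite,linorder}" where
  "coord i = sorted_list_of_set UNIV ! i"

definition to_vec :: "real ^ 'n::{finite,linorder} \<Rightarrow> real Matrix.vec" where
  "to_vec u = Matrix.vec CARD('n) (\<lambda>i. vec_nth u (coord i))"

definition to_mat :: "real ^ 'n::{finite,linorder} ^ 'n::{finite,linorder} \<Rightarrow> real Matrix.mat" where
  "to_mat B = Matrix.mat CARD('n) CARD('n) (\<lambda>(i, j). vec_nth (vec_nth B (coord i)) (coord j))"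

definition normal_matrix ::
  "real ^ 'k \<Rightarrow> ('k \<Rightarrow> real ^ 'n::{finite,linorder} \<Rightarrow> real ^ 'n::{finite,linorder} ^ 'n::{finite,linorder}) \<Rightarrow> real ^ 'n::{finite,linorder} \<Rightarrow> real Matrix.mat" where
  "normal_matrix \<nu> A v = to_mat (\<Sum>i\<in>UNIV. vec_nth \<nu> i *\<^sub>R A i v)"

definition sym_part :: "real Matrix.mat \<Rightarrow> real Matrix.mat" where
  "sym_part B = (1 / 2) \<cdot>\<^sub>m (B + B\<^sup>T)"

definition psd :: "real Matrix.mat \<Rightarrow> bool" where
  "psd X \<longleftrightarrow> square_mat X \<and> X\<^sup>T = X \<and>
     (\<forall>v \<in> carrier_vec (dim_row X). 0 \<le> v \<bullet> (X *\<^sub>v v))"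

definition pos_def :: "real Matrix.mat \<Rightarrow> bool" where
  "pos_def X \<longleftrightarrow> square_mat X \<and> X\<^sup>T = X \<and>
     (\<forall>v \<in> carrier_vec (dim_row X). v \<noteq> 0\<^sub>v (dim_row X) \<longrightarrow> 0 < v \<bullet> (X *\<^sub>v v))"

text \<open>To be applied to invertible matrices only.\<close>

definition mat_inv :: "real Matrix.mat \<Rightarrow> real Matrix.mat" where
  "mat_inv X = the (mat_inverse X)"

definition diag :: "real Matrix.vec \<Rightarrow> real Matrix.mat" where
  "diag l = mat_diag (dim_vec l) (\<lambda>i. l $ i)"

text \<open>Only meant for diagonal matrices. There the entrywise operations agree with
  \<open>diag \<lambda> \<mapsto> diag \<bar>\<lambda>\<bar>\<close> and \<open>diag \<mu> \<mapsto> diag (sqrt \<mu>)\<close>, as the off-diagonal zeros are preserved.\<close>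

abbreviation abs_diag :: "real Matrix.mat \<Rightarrow> real Matrix.mat" where
  "abs_diag \<equiv> map_mat abs"

abbreviation sqrt_diag :: "real Matrix.mat \<Rightarrow> real Matrix.mat" where
  "sqrt_diag \<equiv> map_mat sqrt"

section \<open>Negative and non-negative parts\<close>

definition neg_idx :: "real Matrix.vec \<Rightarrow> nat list" where
  "neg_idx l = filter (\<lambda>i. l $ i < 0) [0..<dim_vec l]"

definition nonneg_idx :: "real Matrix.vec \<Rightarrow> nat list" where
  "nonneg_idx l = filter (\<lambda>i. \<not> l $ i < 0) [0..<dim_vec l]"

definition select :: "nat list \<Rightarrow> real Matrix.vec \<Rightarrow> real Matrix.vec" where
  "select js v = Matrix.vec (length js) (\<lambda>r. v $ (js ! r))"

definition selection_mat :: "nat \<Rightarrow> nat list \<Rightarrow> real Matrix.mat" where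
  "selection_mat n js = Matrix.mat (length js) n (\<lambda>(r, c). if c = js ! r then 1 else 0)"

lemma selection_mat_mult_vec:
  assumes "v \<in> carrier_vec n" and "set js \<subseteq> {0..<n}"
  shows "selection_mat n js *\<^sub>v v = select js v"
proof (rule eq_vecI)
  fix r assume "r < dim_vec (select js v)"
  then have r: "r < length js" by (simp add: select_def)
  then have j: "js ! r < n" using assms(2) nth_mem by fastforce
  have "(selection_mat n js *\<^sub>v v) $ r = (\<Sum>c = 0..<n. (if c = js ! r then 1 else 0) * v $ c)"
    using r assms(1) by (simp add: selection_mat_def scalar_prod_def)
  also have "\<dots> = (\<Sum>c = 0..<n. if c = js ! r then v $ c else 0)"
    by (rule sum.cong) auto
  also have "\<dots> = v $ (js ! r)" using j by simp
  finally show "(selection_mat n js *\<^sub>v v) $ r = select js v $ r"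
    using r by (simp add: select_def)
qed (simp add: selection_mat_def select_def)

end

theory Submission
  imports Defs "Jordan_Normal_Form.Determinant"
begin

text \<open>
  Everything happens at a single boundary point. Put \<open>a = \<surd>|\<Lambda>\<^sup>-| W\<^sup>-\<close> and \<open>b = \<surd>\<Lambda>\<^sup>+ W\<^sup>+\<close>. Since
  \<open>U = T W\<close>, the congruence turns \<open>U\<^sup>T (n\<^sub>i A\<^sub>i) U\<close> into \<open>W\<^sup>T \<Lambda> W\<close>, and sorting the diagonal entries by
  sign gives \<open>W\<^sup>T \<Lambda> W = |b|\<^sup>2 - |a|\<^sup>2\<close> (\<open>diagonal_form_split\<close>). The boundary condition prescribes the
  value \<open>r = R b + S G\<close> for \<open>a\<close>, so all that matters is how large \<open>r\<close> can be.

  The estimate that carries the proof is \<open>|R b + S G|\<^sup>2 \<le> |b|\<^sup>2 + |G|\<^sup>2\<close> (\<open>data_bound\<close>; for \<open>G = 0\<close> it is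
  \<open>contraction_of_psd\<close>). The difference of the two sides is the quadratic form of a symmetric block
  matrix with diagonal blocks \<open>I - R\<^sup>T R\<close> and \<open>I - S\<^sup>T S\<close> and off-diagonal block \<open>- R\<^sup>T S\<close>. The first
  block is positive definite, the matrix in (b) is its Schur complement, and completing the square in
  \<open>b\<close> shows that the form is non-negative.

  With strong imposition \<open>a = r\<close> and the estimate is the claim. With weak imposition the choice
  \<open>\<Sigma> = \<surd>|\<Lambda>\<^sup>-|\<close> turns the penalty into \<open>2 a\<^sup>T (a - r)\<close> (\<open>penalty_work\<close>), and
  \<open>|b|\<^sup>2 - |a|\<^sup>2 + 2 a\<^sup>T (a - r) = |a - r|\<^sup>2 + |b|\<^sup>2 - |r|\<^sup>2\<close>: the square \<open>|a - r|\<^sup>2\<close> only helps, and the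
  same estimate finishes (\<open>weak_form_lower_bound\<close>).

  The Neumann series converges because positive definiteness of \<open>I - R\<^sup>T R\<close> makes \<open>R\<close> a strict
  contraction (\<open>strict_contraction\<close>), so that the powers of \<open>R\<^sup>T R\<close> decay geometrically.
\<close>

section \<open>Scalar products and inverse matrices\<close>

lemma scalar_prod_self_nonneg: "0 \<le> v \<bullet> (v :: real Matrix.vec)"
  by (simp add: scalar_prod_def sum_nonneg)

lemma scalar_prod_self_add:
  fixes v w :: "real Matrix.vec"
  assumes "v \<in> carrier_vec n" "w \<in> carrier_vec n"
  shows "(v + w) \<bullet> (v + w) = v \<bullet> v + 2 * (v \<bullet> w) + w \<bullet> w"
  using assms comm_scalar_prod[OF assms]
  by (simp add: add_scalar_prod_distrib[of _ n] scalar_prod_add_distrib[of _ n])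

lemma scalar_prod_self_diff:
  fixes v w :: "real Matrix.vec"
  assumes "v \<in> carrier_vec n" "w \<in> carrier_vec n"
  shows "(v - w) \<bullet> (v - w) = v \<bullet> v - 2 * (v \<bullet> w) + w \<bullet> w"
  using assms comm_scalar_prod[OF assms]
  by (simp add: minus_scalar_prod_distrib[of _ n] scalar_prod_minus_distrib[of _ n])

lemma diff_diff_vec:
  fixes u v w :: "real Matrix.vec"
  assumes "u \<in> carrier_vec n" "v \<in> carrier_vec n" "w \<in> carrier_vec n"
  shows "u - v - w = u - (v + w)"
  using assms unfolding carrier_dim_vec by (intro eq_vecI) auto

lemma scalar_prod_transpose:
  fixes A :: "real Matrix.mat"
  assumes "A \<in> carrier_mat m n" "v \<in> carrier_vec n" "w \<in> carrier_vec m"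
  shows "v \<bullet> (A\<^sup>T *\<^sub>v w) = (A *\<^sub>v v) \<bullet> w"
  using transpose_vec_mult_scalar[OF assms] comm_scalar_prod[of v n "A\<^sup>T *\<^sub>v w"]
    comm_scalar_prod[of w m "A *\<^sub>v v"] assms by simp

lemma mat_inv_inverse:
  assumes "X \<in> carrier_mat n n" "invertible_mat X"
  shows "mat_inv X \<in> carrier_mat n n" "X * mat_inv X = 1\<^sub>m n" "mat_inv X * X = 1\<^sub>m n"
proof -
  obtain Y where Y: "X * Y = 1\<^sub>m n" "Y * X = 1\<^sub>m (dim_row Y)"
    using assms by (auto simp: invertible_mat_def inverts_mat_def)
  have "dim_row Y = n" using assms(1) arg_cong[OF Y(2), of dim_col] by simp
  moreover have "dim_col Y = n" using arg_cong[OF Y(1), of dim_col] by simp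
  ultimately have "Y \<in> carrier_mat n n" by blast
  with Y \<open>dim_row Y = n\<close> assms(1) have "X \<in> Units (ring_mat TYPE(real) n ())"
    by (auto simp: Units_def ring_mat_def)
  then obtain Z where "mat_inverse X = Some Z"
    using mat_inverse(1)[OF assms(1), of "()"] by (cases "mat_inverse X") auto
  then show "mat_inv X \<in> carrier_mat n n" "X * mat_inv X = 1\<^sub>m n" "mat_inv X * X = 1\<^sub>m n"
    using mat_inverse(2)[OF assms(1)] by (auto simp: mat_inv_def)
qed

section \<open>Positive (semi-)definite forms\<close>

lemma psd_of_pos_def:
  assumes "pos_def X"
  shows "psd X"
  unfolding psd_def
proof (intro conjI ballI)
  fix v :: "real Matrix.vec" assume v: "v \<in> carrier_vec (dim_row X)"
  show "0 \<le> v \<bullet> (X *\<^sub>v v)"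
  proof (cases "v = 0\<^sub>v (dim_row X)")
    case True
    then show ?thesis by (simp add: scalar_prod_def)
  next
    case False
    then show ?thesis using assms v by (auto simp: pos_def_def intro: less_imp_le)
  qed
qed (use assms in \<open>auto simp: pos_def_def\<close>)

lemma pos_def_invertible:
  assumes X: "X \<in> carrier_mat n n" and "pos_def X"
  shows "invertible_mat X"
proof -
  have "v = 0\<^sub>v n" if "v \<in> carrier_vec n" "X *\<^sub>v v = 0\<^sub>v n" for v
    using assms that unfolding pos_def_def
    by (metis carrier_matD(1) less_irrefl scalar_prod_right_zero)
  then have "Determinant.det X \<noteq> 0"
    using det_0_iff_vec_prod_zero[OF X] by blast
  then have "X \<in> Units (ring_mat TYPE(real) n ())"
    by (rule det_non_zero_imp_unit[OF X])
  then show ?thesis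
    using X unfolding Units_def invertible_mat_def inverts_mat_def ring_mat_def by auto
qed

text \<open>Young's inequality for a semi-definite form, obtained by expanding the form at \<open>v - w\<close>. Every use
  below chooses \<open>w\<close> as a multiple of \<open>X\<^sup>-\<^sup>1 q\<close>; this is how squares are completed without ever forming
  a square root of \<open>X\<close>.\<close>

lemma psd_form_Young:
  assumes X: "X \<in> carrier_mat n n" and "psd X"
    and v: "v \<in> carrier_vec n" and w: "w \<in> carrier_vec n"
  shows "2 * (v \<bullet> (X *\<^sub>v w)) \<le> v \<bullet> (X *\<^sub>v v) + w \<bullet> (X *\<^sub>v w)"
proof -
  have sym: "w \<bullet> (X *\<^sub>v v) = v \<bullet> (X *\<^sub>v w)"
    using scalar_prod_transpose[OF X w v] comm_scalar_prod[of v n "X *\<^sub>v w"] X v w \<open>psd X\<close>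
    by (simp add: psd_def)
  have "0 \<le> (v - w) \<bullet> (X *\<^sub>v (v - w))"
    using assms by (auto simp: psd_def)
  also have "\<dots> = v \<bullet> (X *\<^sub>v v) - 2 * (v \<bullet> (X *\<^sub>v w)) + w \<bullet> (X *\<^sub>v w)"
    using X v w sym
    by (simp add: mult_minus_distrib_mat_vec[OF X] minus_scalar_prod_distrib[of _ n]
        scalar_prod_minus_distrib[of _ n])
  finally show ?thesis by simp
qed

section \<open>Bounds on the reflected data\<close>

lemma gram_form:
  fixes R :: "real Matrix.mat"
  assumes R: "R \<in> carrier_mat m p" and v: "v \<in> carrier_vec p" and w: "w \<in> carrier_vec p"
  shows "v \<bullet> (R\<^sup>T * R *\<^sub>v w) = (R *\<^sub>v v) \<bullet> (R *\<^sub>v w)"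
  using scalar_prod_transpose[OF R v, of "R *\<^sub>v w"] R v w
  by (simp add: assoc_mult_mat_vec[of _ p m _ p])

text \<open>Condition (a) says that \<open>R\<close> does not increase Euclidean length: the quadratic form of \<open>I - R\<^sup>T R\<close>
  is the squared length lost under \<open>R\<close>.\<close>

lemma defect_form:
  fixes R :: "real Matrix.mat"
  assumes R: "R \<in> carrier_mat m p" and v: "v \<in> carrier_vec p"
  shows "v \<bullet> ((1\<^sub>m p - R\<^sup>T * R) *\<^sub>v v) = v \<bullet> v - (R *\<^sub>v v) \<bullet> (R *\<^sub>v v)"
proof -
  have RR: "R\<^sup>T * R \<in> carrier_mat p p" using R by simp
  show ?thesis
    using minus_mult_distrib_mat_vec[OF one_carrier_mat RR v] gram_form[OF R v v]
      scalar_prod_minus_distrib[OF v v, of "R\<^sup>T * R *\<^sub>v v"] mult_mat_vec_carrier[OF RR v] v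
    by simp
qed

lemma contraction_of_psd:
  assumes "R \<in> carrier_mat m p" "psd (1\<^sub>m p - R\<^sup>T * R)" "v \<in> carrier_vec p"
  shows "(R *\<^sub>v v) \<bullet> (R *\<^sub>v v) \<le> v \<bullet> v"
  using assms defect_form[OF assms(1,3)] by (fastforce simp: psd_def)

text \<open>With \<open>M = I - R\<^sup>T R\<close> and \<open>q = R\<^sup>T S g\<close> the cross term \<open>2 (R b)\<^sup>T (S g) = 2 b\<^sup>T q\<close> is at most
  \<open>b\<^sup>T M b + q\<^sup>T M\<^sup>-\<^sup>1 q\<close>. The first summand is paid for by \<open>|b|\<^sup>2 - |R b|\<^sup>2\<close>, and condition (b), the
  semi-definiteness of the Schur complement, pays for the second by \<open>|g|\<^sup>2 - |S g|\<^sup>2\<close>.\<close>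

lemma data_bound:
  assumes R: "R \<in> carrier_mat m p" and S: "S \<in> carrier_mat m m"
    and pd: "pos_def (1\<^sub>m p - R\<^sup>T * R)"
    and schur: "psd (1\<^sub>m m - S\<^sup>T * S - (R\<^sup>T * S)\<^sup>T * mat_inv (1\<^sub>m p - R\<^sup>T * R) * (R\<^sup>T * S))"
    and b: "b \<in> carrier_vec p" and g: "g \<in> carrier_vec m"
  shows "(R *\<^sub>v b + S *\<^sub>v g) \<bullet> (R *\<^sub>v b + S *\<^sub>v g) \<le> b \<bullet> b + g \<bullet> g"
proof -
  define M where "M = 1\<^sub>m p - R\<^sup>T * R"
  define N where "N = mat_inv M"
  define Q where "Q = R\<^sup>T * S"
  define q where "q = Q *\<^sub>v g"
  have M: "M \<in> carrier_mat p p" and Q: "Q \<in> carrier_mat p m" using R S by (auto simp: M_def Q_def)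
  have q: "q \<in> carrier_vec p" using Q g by (simp add: q_def)
  have N: "N \<in> carrier_mat p p" "M * N = 1\<^sub>m p"
    using mat_inv_inverse[OF M] pos_def_invertible[OF M] pd by (auto simp: N_def M_def)
  have Nq: "N *\<^sub>v q \<in> carrier_vec p" using N q by simp
  have MNq: "M *\<^sub>v (N *\<^sub>v q) = q"
    using assoc_mult_mat_vec[OF M N(1) q] N(2) q by simp
  have cross: "(R *\<^sub>v b) \<bullet> (S *\<^sub>v g) = b \<bullet> q"
    using scalar_prod_transpose[OF R b, of "S *\<^sub>v g"] R S b g
    by (simp add: q_def Q_def assoc_mult_mat_vec[of _ p m _ m])
  \<comment> \<open>\<open>q\<^sup>T M\<^sup>-\<^sup>1 q\<close> is the amount that condition (b) subtracts.\<close>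
  have QNQ: "g \<bullet> (Q\<^sup>T * N * Q *\<^sub>v g) = (N *\<^sub>v q) \<bullet> q"
  proof -
    have "Q\<^sup>T * N * Q *\<^sub>v g = Q\<^sup>T *\<^sub>v (N *\<^sub>v q)"
      using Q N(1) g q by (simp add: q_def assoc_mult_mat_vec[of _ m p _ m] assoc_mult_mat_vec[of _ m p _ p])
    then show ?thesis
      using scalar_prod_transpose[OF Q g Nq] comm_scalar_prod[OF q Nq] by (simp add: q_def)
  qed
  have "0 \<le> g \<bullet> ((1\<^sub>m m - S\<^sup>T * S - Q\<^sup>T * N * Q) *\<^sub>v g)"
    using schur g Q by (auto simp: psd_def M_def N_def Q_def)
  also have "\<dots> = g \<bullet> g - (S *\<^sub>v g) \<bullet> (S *\<^sub>v g) - (N *\<^sub>v q) \<bullet> q"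
  proof -
    have SS: "1\<^sub>m m - S\<^sup>T * S \<in> carrier_mat m m" and QQ: "Q\<^sup>T * N * Q \<in> carrier_mat m m"
      using S Q N by auto
    show ?thesis
      using minus_mult_distrib_mat_vec[OF SS QQ g] defect_form[OF S g] QNQ
        scalar_prod_minus_distrib[OF g mult_mat_vec_carrier[OF SS g] mult_mat_vec_carrier[OF QQ g]]
      by simp
  qed
  finally have 1: "(S *\<^sub>v g) \<bullet> (S *\<^sub>v g) + (N *\<^sub>v q) \<bullet> q \<le> g \<bullet> g" by simp
  have "2 * (b \<bullet> q) \<le> b \<bullet> b - (R *\<^sub>v b) \<bullet> (R *\<^sub>v b) + (N *\<^sub>v q) \<bullet> q"
    using psd_form_Young[OF M _ b Nq] psd_of_pos_def[OF pd] defect_form[OF R b]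
    by (simp add: MNq flip: M_def)
  with 1 show ?thesis
    using scalar_prod_self_add[of "R *\<^sub>v b" m "S *\<^sub>v g"] R S b g cross by simp
qed

section \<open>The Neumann series\<close>

lemma quadratic_form_bound:
  fixes N :: "real Matrix.mat"
  assumes N: "N \<in> carrier_mat n n" and v: "v \<in> carrier_vec n"
  shows "v \<bullet> (N *\<^sub>v v) \<le> (\<Sum>i<n. \<Sum>j<n. \<bar>N $$ (i, j)\<bar>) * (v \<bullet> v)"
proof -
  have sq: "(v $ i)\<^sup>2 \<le> v \<bullet> v" if "i < n" for i
  proof -
    have "(v $ i)\<^sup>2 \<le> (\<Sum>i\<in>{0..<n}. (v $ i)\<^sup>2)" using that by (intro member_le_sum) auto
    then show ?thesis using v by (simp add: scalar_prod_def power2_eq_square)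
  qed
  have "v \<bullet> (N *\<^sub>v v) = (\<Sum>i<n. \<Sum>j<n. N $$ (i, j) * (v $ i * v $ j))"
    using N v by (simp add: scalar_prod_def sum_distrib_left atLeast0LessThan algebra_simps)
  also have "\<dots> \<le> (\<Sum>i<n. \<Sum>j<n. \<bar>N $$ (i, j)\<bar> * (v \<bullet> v))"
  proof (intro sum_mono)
    fix i j assume ij: "i \<in> {..<n}" "j \<in> {..<n}"
    have "\<bar>v $ i * v $ j\<bar> \<le> v \<bullet> v"
    proof -
      have "2 * \<bar>v $ i * v $ j\<bar> \<le> (v $ i)\<^sup>2 + (v $ j)\<^sup>2"
        using sum_squares_bound[of "\<bar>v $ i\<bar>" "\<bar>v $ j\<bar>"] by (simp add: abs_mult)
      then show ?thesis using sq[of i] sq[of j] ij by simp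
    qed
    then have "\<bar>N $$ (i, j) * (v $ i * v $ j)\<bar> \<le> \<bar>N $$ (i, j)\<bar> * (v \<bullet> v)"
      unfolding abs_mult[of "N $$ (i, j)"] by (intro mult_left_mono) auto
    then show "N $$ (i, j) * (v $ i * v $ j) \<le> \<bar>N $$ (i, j)\<bar> * (v \<bullet> v)" by linarith
  qed
  finally show ?thesis by (simp add: sum_distrib_right)
qed

text \<open>A quantitative form of positive definiteness, read off from the inverse instead of from
  compactness of the unit sphere. If
  \<open>v\<^sup>T M\<^sup>-\<^sup>1 v \<le> K |v|\<^sup>2\<close>, then Young's inequality for \<open>M = I - R\<^sup>T R\<close> with \<open>w = M\<^sup>-\<^sup>1 v / K\<close> reads
  \<open>2 |v|\<^sup>2 / K \<le> v\<^sup>T M v + |v|\<^sup>2 / K\<close>, that is, \<open>|v|\<^sup>2 / K \<le> |v|\<^sup>2 - |R v|\<^sup>2\<close>.\<close>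

lemma strict_contraction:
  assumes R: "R \<in> carrier_mat m p" and pd: "pos_def (1\<^sub>m p - R\<^sup>T * R)"
  obtains c where "0 < c" "c < 1" "\<And>v. v \<in> carrier_vec p \<Longrightarrow> (R *\<^sub>v v) \<bullet> (R *\<^sub>v v) \<le> c * (v \<bullet> v)"
proof -
  define M where "M = 1\<^sub>m p - R\<^sup>T * R"
  define N where "N = mat_inv M"
  \<comment> \<open>The summand 2 makes \<open>K > 1\<close>, so that the factor \<open>1 - 1 / K\<close> is strictly positive.\<close>
  define K where "K = 2 + (\<Sum>i<p. \<Sum>j<p. \<bar>N $$ (i, j)\<bar>)"
  have K: "2 \<le> K" by (auto simp: K_def intro!: sum_nonneg)
  have M: "M \<in> carrier_mat p p" using R by (auto simp: M_def)
  have N: "N \<in> carrier_mat p p" "M * N = 1\<^sub>m p"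
    using mat_inv_inverse[OF M] pos_def_invertible[OF M] pd by (auto simp: N_def M_def)
  have "(R *\<^sub>v v) \<bullet> (R *\<^sub>v v) \<le> (1 - 1 / K) * (v \<bullet> v)" if v: "v \<in> carrier_vec p" for v
  proof -
    define w where "w = (1 / K) \<cdot>\<^sub>v (N *\<^sub>v v)"
    have Nv: "N *\<^sub>v v \<in> carrier_vec p" using N v by simp
    then have w: "w \<in> carrier_vec p" by (simp add: w_def)
    have Mw: "M *\<^sub>v w = (1 / K) \<cdot>\<^sub>v v"
      using assoc_mult_mat_vec[OF M N(1) v] N(2) v by (simp add: w_def mult_mat_vec[OF M Nv])
    have "v \<bullet> (N *\<^sub>v v) \<le> K * (v \<bullet> v)"
      using quadratic_form_bound[OF N(1) v] scalar_prod_self_nonneg[of v]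
      by (simp add: K_def algebra_simps)
    moreover have "w \<bullet> (M *\<^sub>v w) = (v \<bullet> (N *\<^sub>v v)) / K\<^sup>2"
      using v Nv comm_scalar_prod[OF v Nv] unfolding Mw
      by (simp add: w_def power2_eq_square)
    ultimately have "w \<bullet> (M *\<^sub>v w) \<le> (K * (v \<bullet> v)) / K\<^sup>2"
      by (simp add: divide_right_mono)
    then have "w \<bullet> (M *\<^sub>v w) \<le> (v \<bullet> v) / K" using K by (simp add: power2_eq_square)
    moreover have "v \<bullet> (M *\<^sub>v w) = (v \<bullet> v) / K" using v by (simp add: Mw)
    moreover have "2 * (v \<bullet> (M *\<^sub>v w)) \<le> v \<bullet> (M *\<^sub>v v) + w \<bullet> (M *\<^sub>v w)"
      using psd_form_Young[OF M _ v w] psd_of_pos_def pd by (simp add: M_def)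
    ultimately show ?thesis
      using defect_form[OF R v, folded M_def] by (simp add: left_diff_distrib)
  qed
  with K show thesis by (intro that[of "1 - 1 / K"]) auto
qed

text \<open>The bound on \<open>R\<close> passes to \<open>R\<^sup>T R\<close> with \<open>w = R\<^sup>T R v\<close>: from \<open>|w|\<^sup>2 = (R w)\<^sup>T (R v)\<close> and
  \<open>2 c (R w)\<^sup>T (R v) \<le> c\<^sup>2 |R v|\<^sup>2 + |R w|\<^sup>2 \<le> c\<^sup>3 |v|\<^sup>2 + c |w|\<^sup>2\<close> the term \<open>|w|\<^sup>2\<close> can be absorbed.\<close>

lemma gram_contraction:
  fixes R :: "real Matrix.mat"
  assumes R: "R \<in> carrier_mat m p" and c: "0 < c"
    and contr: "\<And>v. v \<in> carrier_vec p \<Longrightarrow> (R *\<^sub>v v) \<bullet> (R *\<^sub>v v) \<le> c * (v \<bullet> v)"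
    and v: "v \<in> carrier_vec p"
  shows "(R\<^sup>T * R *\<^sub>v v) \<bullet> (R\<^sup>T * R *\<^sub>v v) \<le> c\<^sup>2 * (v \<bullet> v)"
proof -
  define w where "w = R\<^sup>T * R *\<^sub>v v"
  have w: "w \<in> carrier_vec p" using R v by (auto simp: w_def)
  let ?x = "R *\<^sub>v v" and ?y = "R *\<^sub>v w"
  have x: "?x \<in> carrier_vec m" and y: "?y \<in> carrier_vec m" using R v w by auto
  have "w \<bullet> w = ?y \<bullet> ?x" using gram_form[OF R w v] by (simp add: w_def)
  moreover have "0 \<le> c\<^sup>2 * (?x \<bullet> ?x) - 2 * c * (?y \<bullet> ?x) + ?y \<bullet> ?y"
    using scalar_prod_self_nonneg[of "c \<cdot>\<^sub>v ?x - ?y"] scalar_prod_self_diff[of "c \<cdot>\<^sub>v ?x" m ?y]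
      x y comm_scalar_prod[OF x y] by (simp add: power2_eq_square algebra_simps)
  moreover have "?y \<bullet> ?y \<le> c * (w \<bullet> w)" using contr[OF w] .
  moreover have "c\<^sup>2 * (?x \<bullet> ?x) \<le> c\<^sup>2 * (c * (v \<bullet> v))"
    using contr[OF v] by (intro mult_left_mono) auto
  ultimately have "c * (w \<bullet> w) \<le> c * (c\<^sup>2 * (v \<bullet> v))" by (simp add: algebra_simps)
  then show ?thesis using c by (simp add: w_def)
qed

text \<open>Geometric decay of \<open>B\<^sup>k v\<close> for \<open>B = R\<^sup>T R\<close> makes all entries of \<open>B\<^sup>k\<close> tend to zero. Multiplying
  \<open>(I - B) B\<^sup>k = B\<^sup>k - B\<^sup>k\<^sup>+\<^sup>1\<close> by the inverse of \<open>I - B\<close> exhibits the series as a finite combination of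
  telescoping ones.\<close>

lemma neumann_series:
  assumes R: "R \<in> carrier_mat m p" and pd: "pos_def (1\<^sub>m p - R\<^sup>T * R)"
    and i: "i < p" and j: "j < p"
  shows "(\<lambda>k. ((R\<^sup>T * R) ^\<^sub>m k) $$ (i, j)) sums (mat_inv (1\<^sub>m p - R\<^sup>T * R) $$ (i, j))"
proof -
  obtain c where c: "0 < c" "c < 1"
    and contr: "\<And>v. v \<in> carrier_vec p \<Longrightarrow> (R *\<^sub>v v) \<bullet> (R *\<^sub>v v) \<le> c * (v \<bullet> v)"
    by (rule strict_contraction[OF R pd]) blast
  define B where "B = R\<^sup>T * R"
  define N where "N = mat_inv (1\<^sub>m p - B)"
  have B: "B \<in> carrier_mat p p" using R by (auto simp: B_def)
  have M: "1\<^sub>m p - B \<in> carrier_mat p p" using minus_carrier_mat[OF B] .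
  have N: "N \<in> carrier_mat p p" "N * (1\<^sub>m p - B) = 1\<^sub>m p"
    using mat_inv_inverse[OF M] pos_def_invertible[OF M] pd by (auto simp: N_def B_def)
  have Bk: "B ^\<^sub>m k \<in> carrier_mat p p" for k using B by simp
  have decay: "((B ^\<^sub>m k) *\<^sub>v v) \<bullet> ((B ^\<^sub>m k) *\<^sub>v v) \<le> (c\<^sup>2) ^ k * (v \<bullet> v)" if "v \<in> carrier_vec p" for k v
    using that
  proof (induction k arbitrary: v)
    case 0
    then show ?case using B by simp
  next
    case (Suc k)
    have Bv: "B *\<^sub>v v \<in> carrier_vec p" using B Suc.prems by simp
    have "((B ^\<^sub>m Suc k) *\<^sub>v v) = (B ^\<^sub>m k) *\<^sub>v (B *\<^sub>v v)"
      using assoc_mult_mat_vec[OF Bk B Suc.prems] by simp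
    moreover have "(c\<^sup>2) ^ k * ((B *\<^sub>v v) \<bullet> (B *\<^sub>v v)) \<le> (c\<^sup>2) ^ k * (c\<^sup>2 * (v \<bullet> v))"
      using gram_contraction[OF R c(1) contr Suc.prems] by (intro mult_left_mono) (auto simp: B_def)
    ultimately show ?case using Suc.IH[OF Bv] by (simp add: algebra_simps)
  qed
  have tend: "(\<lambda>k. (B ^\<^sub>m k) $$ (r, j)) \<longlonglongrightarrow> 0" if r: "r < p" for r
  proof -
    have sq: "((B ^\<^sub>m k) $$ (r, j))\<^sup>2 \<le> (c\<^sup>2) ^ k" for k
    proof -
      let ?e = "unit_vec p j"
      let ?z = "(B ^\<^sub>m k) *\<^sub>v ?e"
      have "?z $ r = (B ^\<^sub>m k) $$ (r, j)" using B r j by simp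
      moreover have "(?z $ r)\<^sup>2 \<le> (\<Sum>i\<in>{0..<p}. (?z $ i)\<^sup>2)"
        using r by (intro member_le_sum) auto
      moreover have "\<dots> = ?z \<bullet> ?z"
        using B by (simp add: scalar_prod_def power2_eq_square del: index_mult_mat_vec)
      ultimately show ?thesis using decay[of ?e k] j by simp
    qed
    have "(\<lambda>k. ((B ^\<^sub>m k) $$ (r, j))\<^sup>2) \<longlonglongrightarrow> 0"
    proof (rule tendsto_sandwich[OF _ _ tendsto_const LIMSEQ_realpow_zero[of "c\<^sup>2"]])
      show "c\<^sup>2 < 1" using c by (simp add: power_less_one_iff abs_square_less_1)
    qed (use sq in auto)
    from tendsto_real_sqrt[OF this] show ?thesis by (simp add: tendsto_rabs_zero_iff)
  qed
  have entry: "(B ^\<^sub>m k) $$ (i, j) = (\<Sum>r<p. N $$ (i, r) * ((B ^\<^sub>m k) $$ (r, j) - (B ^\<^sub>m Suc k) $$ (r, j)))" for k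
  proof -
    have eq: "B ^\<^sub>m k = N * (B ^\<^sub>m k - B ^\<^sub>m Suc k)"
    proof -
      have comm: "B ^\<^sub>m Suc k = B * B ^\<^sub>m k"
      proof (induction k)
        case 0
        show ?case using B by simp
      next
        case (Suc k)
        have "B ^\<^sub>m Suc (Suc k) = B * B ^\<^sub>m k * B" using Suc.IH by simp
        also have "\<dots> = B * B ^\<^sub>m Suc k" using assoc_mult_mat[OF B Bk B] by simp
        finally show ?case .
      qed
      have "N * (B ^\<^sub>m k - B ^\<^sub>m Suc k) = N * ((1\<^sub>m p - B) * B ^\<^sub>m k)"
        unfolding comm minus_mult_distrib_mat[OF one_carrier_mat B Bk] left_mult_one_mat[OF Bk] ..
      also have "\<dots> = B ^\<^sub>m k"
        unfolding assoc_mult_mat[OF N(1) M Bk, symmetric] N(2) by (rule left_mult_one_mat[OF Bk])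
      finally show ?thesis by simp
    qed
    have "(N * (P - Q)) $$ (i, j) = (\<Sum>r<p. N $$ (i, r) * (P $$ (r, j) - Q $$ (r, j)))"
      if "P \<in> carrier_mat p p" "Q \<in> carrier_mat p p" for P Q
      using that N(1) i j by (simp add: scalar_prod_def atLeast0LessThan)
    from this[OF Bk[of k] Bk[of "Suc k"], folded eq] show ?thesis .
  qed
  have "(\<lambda>k. \<Sum>r<p. N $$ (i, r) * ((B ^\<^sub>m k) $$ (r, j) - (B ^\<^sub>m Suc k) $$ (r, j))) sums
      (\<Sum>r<p. N $$ (i, r) * ((B ^\<^sub>m 0) $$ (r, j) - 0))"
    by (intro sums_sum sums_mult telescope_sums' tend) auto
  moreover have "(\<Sum>r<p. N $$ (i, r) * ((B ^\<^sub>m 0) $$ (r, j) - 0)) = N $$ (i, j)"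
    using B j by (simp add: if_distrib[of "\<lambda>x. _ * x"] cong: if_cong)
  ultimately have "(\<lambda>k. (B ^\<^sub>m k) $$ (i, j)) sums (N $$ (i, j))"
    using entry by simp
  then show ?thesis by (simp add: B_def N_def)
qed

section \<open>The boundary form in transformed variables\<close>

lemma diag_mult_vec: "diag l *\<^sub>v v = Matrix.vec (dim_vec l) (\<lambda>i. l $ i * v $ i)"
  if "dim_vec v = dim_vec l"
proof (rule eq_vecI)
  fix i assume "i < dim_vec (Matrix.vec (dim_vec l) (\<lambda>i. l $ i * v $ i))"
  then show "(diag l *\<^sub>v v) $ i = Matrix.vec (dim_vec l) (\<lambda>i. l $ i * v $ i) $ i"
    using that
    by (simp add: diag_def mat_diag_def scalar_prod_def if_distrib[of "\<lambda>x. x * _"] cong: if_cong)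
qed (simp add: diag_def mat_diag_def)

lemma map_mat_diag: "map_mat f (diag l) = diag (map_vec f l)" if "f 0 = 0"
  by (rule eq_matI) (auto simp: diag_def mat_diag_def that)

lemma diag_symmetric: "(diag l)\<^sup>T = diag l"
  by (rule eq_matI) (auto simp: diag_def mat_diag_def)

text \<open>The square roots are chosen so that the entries of \<open>\<Lambda>\<close> are absorbed into the vectors; the minus
  sign is the sign of the entries that \<open>neg_idx\<close> selects.\<close>

lemma diagonal_form_split:
  assumes W: "W \<in> carrier_vec n" and l: "l \<in> carrier_vec n"
  defines "a \<equiv> sqrt_diag (abs_diag (diag (select (neg_idx l) l))) *\<^sub>v select (neg_idx l) W"
    and "b \<equiv> sqrt_diag (diag (select (nonneg_idx l) l)) *\<^sub>v select (nonneg_idx l) W"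
  shows "W \<bullet> (diag l *\<^sub>v W) = b \<bullet> b - a \<bullet> a"
proof -
  have listsum: "(\<Sum>r = 0..<length js. f (js ! r)) = sum f (set js)" if "distinct js" for js and f :: "nat \<Rightarrow> real"
    using that by (simp add: sum.distinct_set_conv_list sum_list_sum_nth)
  have neg: "\<And>i. i \<in> set (neg_idx l) \<Longrightarrow> l $ i < 0" and neg_d: "distinct (neg_idx l)"
    and nn: "\<And>i. i \<in> set (nonneg_idx l) \<Longrightarrow> 0 \<le> l $ i" and nn_d: "distinct (nonneg_idx l)"
    by (auto simp: neg_idx_def nonneg_idx_def)
  have "a = Matrix.vec (length (neg_idx l)) (\<lambda>r. sqrt \<bar>l $ (neg_idx l ! r)\<bar> * W $ (neg_idx l ! r))"
    unfolding a_def by (subst map_mat_diag, simp, subst map_mat_diag, simp, subst diag_mult_vec)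
      (auto simp: select_def)
  then have "a \<bullet> a = (\<Sum>r = 0..<length (neg_idx l). (\<lambda>i. \<bar>l $ i\<bar> * (W $ i)\<^sup>2) (neg_idx l ! r))"
    by (simp add: scalar_prod_def power2_eq_square algebra_simps)
  also have "\<dots> = (\<Sum>i\<in>set (neg_idx l). - (l $ i * (W $ i)\<^sup>2))"
    by (subst listsum[OF neg_d]) (use neg in \<open>auto intro!: sum.cong simp: abs_of_neg\<close>)
  finally have a: "a \<bullet> a = - (\<Sum>i\<in>set (neg_idx l). l $ i * (W $ i)\<^sup>2)" by (simp add: sum_negf)
  have "b = Matrix.vec (length (nonneg_idx l)) (\<lambda>r. sqrt (l $ (nonneg_idx l ! r)) * W $ (nonneg_idx l ! r))"
    unfolding b_def by (subst map_mat_diag, simp, subst diag_mult_vec) (auto simp: select_def)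
  then have "b \<bullet> b = (\<Sum>r = 0..<length (nonneg_idx l). (\<lambda>i. \<bar>l $ i\<bar> * (W $ i)\<^sup>2) (nonneg_idx l ! r))"
    by (simp add: scalar_prod_def power2_eq_square algebra_simps)
  also have "\<dots> = (\<Sum>i\<in>set (nonneg_idx l). l $ i * (W $ i)\<^sup>2)"
    by (subst listsum[OF nn_d]) (use nn in \<open>auto intro!: sum.cong\<close>)
  finally have b: "b \<bullet> b = (\<Sum>i\<in>set (nonneg_idx l). l $ i * (W $ i)\<^sup>2)" .
  have "W \<bullet> (diag l *\<^sub>v W) = (\<Sum>i\<in>{0..<n}. l $ i * (W $ i)\<^sup>2)"
    using W l by (simp add: diag_mult_vec scalar_prod_def power2_eq_square algebra_simps)
  also have "{0..<n} = set (neg_idx l) \<union> set (nonneg_idx l)"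
    using l by (auto simp: neg_idx_def nonneg_idx_def)
  also have "(\<Sum>i\<in>\<dots>. l $ i * (W $ i)\<^sup>2) = b \<bullet> b - a \<bullet> a"
    unfolding a b by (subst sum.union_disjoint) (auto simp: neg_idx_def nonneg_idx_def)
  finally show ?thesis .
qed

text \<open>A matrix and its transpose have the same quadratic form.\<close>

lemma sym_part_form:
  assumes B: "B \<in> carrier_mat n n" and v: "v \<in> carrier_vec n"
  shows "v \<bullet> (sym_part B *\<^sub>v v) = v \<bullet> (B *\<^sub>v v)"
proof -
  have BT: "B\<^sup>T \<in> carrier_mat n n" using B by simp
  have c1: "B *\<^sub>v v \<in> carrier_vec n" and c2: "B\<^sup>T *\<^sub>v v \<in> carrier_vec n" using B v by auto
  have "((1 / 2) \<cdot>\<^sub>m (B + B\<^sup>T)) *\<^sub>v v = (1 / 2) \<cdot>\<^sub>v (B *\<^sub>v v + B\<^sup>T *\<^sub>v v)"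
    using add_mult_distrib_mat_vec[OF B BT v] B v by (intro eq_vecI) (auto simp: add_scalar_prod_distrib[of _ n])
  then show ?thesis
    using scalar_prod_transpose[OF B v v] comm_scalar_prod[OF v c1] c1 c2 v
    by (simp add: sym_part_def scalar_prod_add_distrib[OF v c1 c2])
qed

lemma congruence_form:
  fixes X :: "real Matrix.mat"
  assumes T: "T \<in> carrier_mat n n" and inv: "invertible_mat T" and X: "X \<in> carrier_mat n n"
    and u: "u \<in> carrier_vec n"
  shows "(mat_inv T *\<^sub>v u) \<bullet> (T\<^sup>T * X * T *\<^sub>v (mat_inv T *\<^sub>v u)) = u \<bullet> (X *\<^sub>v u)"
proof -
  define w where "w = mat_inv T *\<^sub>v u"
  note N = mat_inv_inverse[OF T inv]
  have w: "w \<in> carrier_vec n" using N u by (simp add: w_def)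
  have Tw: "T *\<^sub>v w = u" using assoc_mult_mat_vec[OF T N(1) u] N(2) u by (simp add: w_def)
  have "T\<^sup>T * X * T *\<^sub>v w = T\<^sup>T *\<^sub>v (X *\<^sub>v u)"
    using T X w by (simp add: assoc_mult_mat_vec[of _ n n _ n] Tw)
  then show ?thesis
    using scalar_prod_transpose[OF T w, of "X *\<^sub>v u"] X u by (simp add: Tw flip: w_def)
qed

text \<open>Testing with \<open>u\<close> undoes the transposed factor of the penalty: \<open>I\<^sup>- T\<^sup>-\<^sup>1 u = W\<^sup>-\<close>. A symmetric penalty
  matrix \<open>D\<close> can then be moved to \<open>W\<^sup>-\<close>, and for \<open>D = \<surd>|\<Lambda>\<^sup>-|\<close> this produces the same vector that occurs in
  the residual \<open>d\<close> of the boundary condition.\<close>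

lemma penalty_work:
  assumes T: "T \<in> carrier_mat n n" "invertible_mat T" and js: "set js \<subseteq> {0..<n}"
    and D: "D \<in> carrier_mat (length js) (length js)" "D\<^sup>T = D"
    and u: "u \<in> carrier_vec n" and d: "d \<in> carrier_vec (length js)"
  shows "u \<bullet> ((selection_mat n js * mat_inv T)\<^sup>T *\<^sub>v (D *\<^sub>v d))
       = (D *\<^sub>v select js (mat_inv T *\<^sub>v u)) \<bullet> d"
proof -
  note N = mat_inv_inverse(1)[OF T]
  have E: "selection_mat n js \<in> carrier_mat (length js) n" by (simp add: selection_mat_def)
  have sel: "selection_mat n js * mat_inv T *\<^sub>v u = select js (mat_inv T *\<^sub>v u)"
    using assoc_mult_mat_vec[OF E N u] selection_mat_mult_vec[OF _ js] N u by simp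
  have c: "select js (mat_inv T *\<^sub>v u) \<in> carrier_vec (length js)" by (simp add: select_def)
  have "u \<bullet> ((selection_mat n js * mat_inv T)\<^sup>T *\<^sub>v (D *\<^sub>v d))
      = select js (mat_inv T *\<^sub>v u) \<bullet> (D *\<^sub>v d)"
    using scalar_prod_transpose[OF mult_carrier_mat[OF E N] u, of "D *\<^sub>v d"] D d sel by simp
  then show ?thesis using scalar_prod_transpose[OF D(1) c d] D(2) by simp
qed

text \<open>The penalty \<open>2 a\<^sup>T (a - r)\<close> replaces \<open>- |a|\<^sup>2\<close> by \<open>|a - r|\<^sup>2 - |r|\<^sup>2\<close>, so that the unknown \<open>a\<close> need not
  be related to the prescribed value \<open>r\<close>.\<close>

lemma weak_form_lower_bound:
  fixes a b r :: "real Matrix.vec"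
  assumes "a \<in> carrier_vec m" "r \<in> carrier_vec m" and "r \<bullet> r \<le> b \<bullet> b + \<gamma>"
  shows "- \<gamma> \<le> b \<bullet> b - a \<bullet> a + 2 * (a \<bullet> (a - r))"
  using scalar_prod_self_nonneg[of "a - r"] scalar_prod_self_diff[OF assms(1,2)] assms(3)
    scalar_prod_minus_distrib[OF assms(1,1,2)] by simp

section \<open>From pointwise estimates to boundary integrals\<close>

lemma boundary_integral_cong:
  "boundary_integral \<Omega> f = boundary_integral \<Omega> g" if "\<And>x. x \<in> frontier \<Omega> \<Longrightarrow> f x = g x"
  unfolding boundary_integral_def set_lebesgue_integral_def
  by (rule Bochner_Integration.integral_cong) (auto simp: indicator_def that)

lemma boundary_integral_nonneg:
  "0 \<le> boundary_integral \<Omega> f" if "\<And>x. x \<in> frontier \<Omega> \<Longrightarrow> 0 \<le> f x"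
  unfolding boundary_integral_def set_lebesgue_integral_def
  by (rule Bochner_Integration.integral_nonneg) (auto simp: indicator_def that)

text \<open>The integral of a function that is not integrable is zero, and zero is above the lower bound because
  \<open>g\<close> is non-negative; otherwise the integral is monotone.\<close>

lemma boundary_integral_lower_bound:
  assumes g: "set_integrable surface_measure (frontier \<Omega>) g"
    and "\<And>x. x \<in> frontier \<Omega> \<Longrightarrow> 0 \<le> g x"
    and "\<And>x. x \<in> frontier \<Omega> \<Longrightarrow> - g x \<le> f x"
  shows "- boundary_integral \<Omega> g \<le> boundary_integral \<Omega> f"
proof (cases "set_integrable surface_measure (frontier \<Omega>) f")
  case True
  have "0 \<le> boundary_integral \<Omega> (\<lambda>x. f x + g x)"
    by (rule boundary_integral_nonneg) (use assms(3) in force)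
  then show ?thesis using True g by (simp add: boundary_integral_def set_integral_add)
next
  case False
  then have "boundary_integral \<Omega> f = 0"
    by (simp add: boundary_integral_def set_lebesgue_integral_def set_integrable_def
        not_integrable_integral_eq)
  then show ?thesis using boundary_integral_nonneg[of \<Omega> g] assms(2) by simp
qed

theorem lemma4p2:
  fixes \<Omega> :: "(real ^ 'k) set"
    and \<nu> :: "real ^ 'k \<Rightarrow> real ^ 'k"
    and U V :: "real ^ 'k \<Rightarrow> real ^ 'n::{finite,linorder}"
    and A :: "'k \<Rightarrow> real ^ 'n::{finite,linorder} \<Rightarrow> real ^ 'n::{finite,linorder} ^ 'n::{finite,linorder}"
    and nA At T \<Lambda> \<Lambda>m \<Lambda>p Isel R S \<Sigma> :: "real ^ 'k \<Rightarrow> real Matrix.mat"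
    and lam W Wm Wp G u :: "real ^ 'k \<Rightarrow> real Matrix.vec"
    and n :: nat and mm mp :: "real ^ 'k \<Rightarrow> nat"
  assumes domain: "open \<Omega>" "connected \<Omega>" "\<Omega> \<noteq> {}"
    and normal: "\<And>x. x \<in> frontier \<Omega> \<Longrightarrow> outward_unit_normal \<Omega> x (\<nu> x)"
    and U_smooth: "smooth_on U (closure \<Omega>)"
    and A_smooth: "\<And>i. smooth_on (A i) (V ` closure \<Omega>)"
    and n_def: "n = CARD('n)"
    and u_def: "\<And>x. u x = to_vec (U x)"
    and nA_def: "\<And>x. nA x = normal_matrix (\<nu> x) A (V x)"
    and At_def: "\<And>x. At x = sym_part (nA x)"
    and T: "\<And>x. x \<in> frontier \<Omega> \<Longrightarrow> T x \<in> carrier_mat n n \<and> invertible_mat (T x)"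
    and lam: "\<And>x. x \<in> frontier \<Omega> \<Longrightarrow> lam x \<in> carrier_vec n"
    and \<Lambda>_def: "\<And>x. \<Lambda> x = diag (lam x)"
    and congruence: "\<And>x. x \<in> frontier \<Omega> \<Longrightarrow> (T x)\<^sup>T * At x * T x = \<Lambda> x"
    and W_def: "\<And>x. W x = mat_inv (T x) *\<^sub>v u x"
    and mm_def: "\<And>x. mm x = length (neg_idx (lam x))"
    and mp_def: "\<And>x. mp x = length (nonneg_idx (lam x))"
    and Wm_def: "\<And>x. Wm x = select (neg_idx (lam x)) (W x)"
    and Wp_def: "\<And>x. Wp x = select (nonneg_idx (lam x)) (W x)"
    and \<Lambda>m_def: "\<And>x. \<Lambda>m x = diag (select (neg_idx (lam x)) (lam x))"
    and \<Lambda>p_def: "\<And>x. \<Lambda>p x = diag (select (nonneg_idx (lam x)) (lam x))"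
    and Isel_def: "\<And>x. Isel x = selection_mat n (neg_idx (lam x))"
    and R: "\<And>x. x \<in> frontier \<Omega> \<Longrightarrow> R x \<in> carrier_mat (mm x) (mp x)"
    and S: "\<And>x. x \<in> frontier \<Omega> \<Longrightarrow> S x \<in> carrier_mat (mm x) (mm x) \<and> invertible_mat (S x)"
    and G: "\<And>x. x \<in> frontier \<Omega> \<Longrightarrow> G x \<in> carrier_vec (mm x)"
    and G_integrable: "set_integrable surface_measure (frontier \<Omega>) (\<lambda>x. G x \<bullet> G x)"
  shows
    "(boundary_integral \<Omega> (\<lambda>x. u x \<bullet> (nA x *\<^sub>v u x)) = boundary_integral \<Omega> (\<lambda>x. u x \<bullet> (At x *\<^sub>v u x)) \<and>
     boundary_integral \<Omega> (\<lambda>x. u x \<bullet> (At x *\<^sub>v u x)) = boundary_integral \<Omega> (\<lambda>x. W x \<bullet> (\<Lambda> x *\<^sub>v W x))) \<and>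
     ((\<forall>x\<in>frontier \<Omega>. sqrt_diag (abs_diag (\<Lambda>m x)) *\<^sub>v Wm x =
        R x *\<^sub>v (sqrt_diag (\<Lambda>p x) *\<^sub>v Wp x) + S x *\<^sub>v 0\<^sub>v (mm x)) \<longrightarrow>
     (\<forall>x\<in>frontier \<Omega>. psd (1\<^sub>m (mp x) - (R x)\<^sup>T * R x)) \<longrightarrow>
     boundary_integral \<Omega> (\<lambda>x. W x \<bullet> (\<Lambda> x *\<^sub>v W x)) \<ge> 0) \<and>
     ((\<forall>x\<in>frontier \<Omega>. pos_def (1\<^sub>m (mp x) - (R x)\<^sup>T * R x)) \<longrightarrow>
     (\<forall>x\<in>frontier \<Omega>. \<forall>i<mp x. \<forall>j<mp x.
        (\<lambda>k. (((R x)\<^sup>T * R x) ^\<^sub>m k) $$ (i, j)) sums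
          (mat_inv (1\<^sub>m (mp x) - (R x)\<^sup>T * R x) $$ (i, j)))) \<and>
     ((\<forall>x\<in>frontier \<Omega>. sqrt_diag (abs_diag (\<Lambda>m x)) *\<^sub>v Wm x =
        R x *\<^sub>v (sqrt_diag (\<Lambda>p x) *\<^sub>v Wp x) + S x *\<^sub>v G x) \<longrightarrow>
     (\<forall>x\<in>frontier \<Omega>. pos_def (1\<^sub>m (mp x) - (R x)\<^sup>T * R x)) \<longrightarrow>
     (\<forall>x\<in>frontier \<Omega>. psd (1\<^sub>m (mm x) - (S x)\<^sup>T * S x -
        ((R x)\<^sup>T * S x)\<^sup>T * mat_inv (1\<^sub>m (mp x) - (R x)\<^sup>T * R x) * ((R x)\<^sup>T * S x))) \<longrightarrow>
     boundary_integral \<Omega> (\<lambda>x. W x \<bullet> (\<Lambda> x *\<^sub>v W x)) \<ge> - boundary_integral \<Omega> (\<lambda>x. G x \<bullet> G x)) \<and>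
     ((\<forall>x\<in>frontier \<Omega>. psd (1\<^sub>m (mp x) - (R x)\<^sup>T * R x)) \<longrightarrow>
     (\<forall>x\<in>frontier \<Omega>. \<Sigma> x = sqrt_diag (abs_diag (\<Lambda>m x))) \<longrightarrow>
     boundary_integral \<Omega> (\<lambda>x. W x \<bullet> (\<Lambda> x *\<^sub>v W x) +
        2 * (u x \<bullet> ((Isel x * mat_inv (T x))\<^sup>T *\<^sub>v (\<Sigma> x *\<^sub>v
          (sqrt_diag (abs_diag (\<Lambda>m x)) *\<^sub>v Wm x - R x *\<^sub>v (sqrt_diag (\<Lambda>p x) *\<^sub>v Wp x)))))) \<ge> 0) \<and>
     ((\<forall>x\<in>frontier \<Omega>. pos_def (1\<^sub>m (mp x) - (R x)\<^sup>T * R x)) \<longrightarrow>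
     (\<forall>x\<in>frontier \<Omega>. psd (1\<^sub>m (mm x) - (S x)\<^sup>T * S x -
        ((R x)\<^sup>T * S x)\<^sup>T * mat_inv (1\<^sub>m (mp x) - (R x)\<^sup>T * R x) * ((R x)\<^sup>T * S x))) \<longrightarrow>
     (\<forall>x\<in>frontier \<Omega>. \<Sigma> x = sqrt_diag (abs_diag (\<Lambda>m x))) \<longrightarrow>
     boundary_integral \<Omega> (\<lambda>x. W x \<bullet> (\<Lambda> x *\<^sub>v W x) +
        2 * (u x \<bullet> ((Isel x * mat_inv (T x))\<^sup>T *\<^sub>v (\<Sigma> x *\<^sub>v
          (sqrt_diag (abs_diag (\<Lambda>m x)) *\<^sub>v Wm x - R x *\<^sub>v (sqrt_diag (\<Lambda>p x) *\<^sub>v Wp x) - S x *\<^sub>v G x)))))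
       \<ge> - boundary_integral \<Omega> (\<lambda>x. G x \<bullet> G x))"
proof -
  define a where "a x = sqrt_diag (abs_diag (\<Lambda>m x)) *\<^sub>v Wm x" for x
  define b where "b x = sqrt_diag (\<Lambda>p x) *\<^sub>v Wp x" for x
  have u: "u x \<in> carrier_vec n" for x by (simp add: u_def n_def to_vec_def)
  have nA: "nA x \<in> carrier_mat n n" for x by (simp add: nA_def n_def normal_matrix_def to_mat_def)
  have At: "At x \<in> carrier_mat n n" for x using nA[of x] by (simp add: At_def sym_part_def)
  have W: "W x \<in> carrier_vec n" if "x \<in> frontier \<Omega>" for x
    using mat_inv_inverse(1)[of "T x" n] T[OF that] u by (auto simp: W_def)
  have D: "sqrt_diag (abs_diag (\<Lambda>m x)) \<in> carrier_mat (mm x) (mm x)"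
    "(sqrt_diag (abs_diag (\<Lambda>m x)))\<^sup>T = sqrt_diag (abs_diag (\<Lambda>m x))" for x
    by (simp add: \<Lambda>m_def mm_def select_def diag_def)
      (simp add: \<Lambda>m_def map_mat_diag diag_symmetric)
  have a: "a x \<in> carrier_vec (mm x)" and b: "b x \<in> carrier_vec (mp x)" for x
    by (simp_all add: carrier_dim_vec a_def b_def \<Lambda>m_def \<Lambda>p_def mm_def mp_def diag_def
        select_def mat_diag_def)
  have split: "W x \<bullet> (\<Lambda> x *\<^sub>v W x) = b x \<bullet> b x - a x \<bullet> a x" if "x \<in> frontier \<Omega>" for x
    unfolding \<Lambda>_def a_def b_def Wm_def Wp_def \<Lambda>m_def \<Lambda>p_def
    by (rule diagonal_form_split[OF W[OF that] lam[OF that]])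
  have work: "u x \<bullet> ((Isel x * mat_inv (T x))\<^sup>T *\<^sub>v (\<Sigma> x *\<^sub>v d)) = a x \<bullet> d"
    if "x \<in> frontier \<Omega>" "\<Sigma> x = sqrt_diag (abs_diag (\<Lambda>m x))" "d \<in> carrier_vec (mm x)" for x d
    unfolding Isel_def a_def Wm_def W_def that(2)
    by (rule penalty_work[OF _ _ _ D[unfolded mm_def] u that(3)[unfolded mm_def]])
      (use T[OF that(1)] lam[OF that(1)] in \<open>auto simp: neg_idx_def\<close>)
  have Rb: "R x *\<^sub>v b x \<in> carrier_vec (mm x)" if "x \<in> frontier \<Omega>" for x
    using R[OF that] b[of x] by simp
  have SG: "S x *\<^sub>v g \<in> carrier_vec (mm x)" if "x \<in> frontier \<Omega>" "g \<in> carrier_vec (mm x)" for x g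
    by (rule mult_mat_vec_carrier[OF conjunct1[OF S[OF that(1)]] that(2)])
  have zero: "R x *\<^sub>v b x + S x *\<^sub>v 0\<^sub>v (mm x) = R x *\<^sub>v b x" if "x \<in> frontier \<Omega>" for x
  proof -
    have "S x *\<^sub>v 0\<^sub>v (mm x) = 0\<^sub>v (mm x)" using S[OF that] by (intro eq_vecI) auto
    then show ?thesis using Rb[OF that] by simp
  qed
  show ?thesis
    unfolding a_def[symmetric] b_def[symmetric]
  proof (intro conjI impI)
    show "boundary_integral \<Omega> (\<lambda>x. u x \<bullet> (nA x *\<^sub>v u x)) = boundary_integral \<Omega> (\<lambda>x. u x \<bullet> (At x *\<^sub>v u x))"
      by (rule boundary_integral_cong) (simp add: At_def sym_part_form[OF nA u])
    show "boundary_integral \<Omega> (\<lambda>x. u x \<bullet> (At x *\<^sub>v u x)) = boundary_integral \<Omega> (\<lambda>x. W x \<bullet> (\<Lambda> x *\<^sub>v W x))"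
    proof (rule boundary_integral_cong)
      fix x assume x: "x \<in> frontier \<Omega>"
      show "u x \<bullet> (At x *\<^sub>v u x) = W x \<bullet> (\<Lambda> x *\<^sub>v W x)"
        unfolding W_def congruence[OF x, symmetric] using T[OF x] congruence_form[OF _ _ At u] by simp
    qed
  next
    assume bc: "\<forall>x\<in>frontier \<Omega>. a x = R x *\<^sub>v b x + S x *\<^sub>v 0\<^sub>v (mm x)"
      and defect: "\<forall>x\<in>frontier \<Omega>. psd (1\<^sub>m (mp x) - (R x)\<^sup>T * R x)"
    show "boundary_integral \<Omega> (\<lambda>x. W x \<bullet> (\<Lambda> x *\<^sub>v W x)) \<ge> 0"
      by (rule boundary_integral_nonneg)
        (use bc zero split defect contraction_of_psd[OF R _ b] in fastforce)
  next
    assume "\<forall>x\<in>frontier \<Omega>. pos_def (1\<^sub>m (mp x) - (R x)\<^sup>T * R x)"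
    then show "\<forall>x\<in>frontier \<Omega>. \<forall>i<mp x. \<forall>j<mp x.
        (\<lambda>k. (((R x)\<^sup>T * R x) ^\<^sub>m k) $$ (i, j)) sums
          (mat_inv (1\<^sub>m (mp x) - (R x)\<^sup>T * R x) $$ (i, j))"
      using neumann_series R by blast
  next
    assume bc: "\<forall>x\<in>frontier \<Omega>. a x = R x *\<^sub>v b x + S x *\<^sub>v G x"
      and defect: "\<forall>x\<in>frontier \<Omega>. pos_def (1\<^sub>m (mp x) - (R x)\<^sup>T * R x)"
      and schur: "\<forall>x\<in>frontier \<Omega>. psd (1\<^sub>m (mm x) - (S x)\<^sup>T * S x -
        ((R x)\<^sup>T * S x)\<^sup>T * mat_inv (1\<^sub>m (mp x) - (R x)\<^sup>T * R x) * ((R x)\<^sup>T * S x))"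
    show "boundary_integral \<Omega> (\<lambda>x. W x \<bullet> (\<Lambda> x *\<^sub>v W x)) \<ge> - boundary_integral \<Omega> (\<lambda>x. G x \<bullet> G x)"
    proof (rule boundary_integral_lower_bound[OF G_integrable scalar_prod_self_nonneg])
      fix x assume x: "x \<in> frontier \<Omega>"
      show "- (G x \<bullet> G x) \<le> W x \<bullet> (\<Lambda> x *\<^sub>v W x)"
        using data_bound[OF R[OF x] conjunct1[OF S[OF x]] bspec[OF defect x] bspec[OF schur x] b G[OF x]]
          bspec[OF bc x] split[OF x] by simp
    qed
  next
    assume defect: "\<forall>x\<in>frontier \<Omega>. psd (1\<^sub>m (mp x) - (R x)\<^sup>T * R x)"
      and \<Sigma>: "\<forall>x\<in>frontier \<Omega>. \<Sigma> x = sqrt_diag (abs_diag (\<Lambda>m x))"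
    show "boundary_integral \<Omega> (\<lambda>x. W x \<bullet> (\<Lambda> x *\<^sub>v W x) +
        2 * (u x \<bullet> ((Isel x * mat_inv (T x))\<^sup>T *\<^sub>v (\<Sigma> x *\<^sub>v (a x - R x *\<^sub>v b x))))) \<ge> 0"
    proof (rule boundary_integral_nonneg)
      fix x assume x: "x \<in> frontier \<Omega>"
      have d: "a x - R x *\<^sub>v b x \<in> carrier_vec (mm x)" using a Rb[OF x] by simp
      have "(R x *\<^sub>v b x) \<bullet> (R x *\<^sub>v b x) \<le> b x \<bullet> b x + 0"
        using contraction_of_psd[OF R[OF x] bspec[OF defect x] b] by simp
      from weak_form_lower_bound[OF a Rb[OF x] this]
      show "0 \<le> W x \<bullet> (\<Lambda> x *\<^sub>v W x) +
          2 * (u x \<bullet> ((Isel x * mat_inv (T x))\<^sup>T *\<^sub>v (\<Sigma> x *\<^sub>v (a x - R x *\<^sub>v b x))))"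
        unfolding work[OF x bspec[OF \<Sigma> x] d] split[OF x] by simp
    qed
  next
    assume defect: "\<forall>x\<in>frontier \<Omega>. pos_def (1\<^sub>m (mp x) - (R x)\<^sup>T * R x)"
      and schur: "\<forall>x\<in>frontier \<Omega>. psd (1\<^sub>m (mm x) - (S x)\<^sup>T * S x -
        ((R x)\<^sup>T * S x)\<^sup>T * mat_inv (1\<^sub>m (mp x) - (R x)\<^sup>T * R x) * ((R x)\<^sup>T * S x))"
      and \<Sigma>: "\<forall>x\<in>frontier \<Omega>. \<Sigma> x = sqrt_diag (abs_diag (\<Lambda>m x))"
    show "boundary_integral \<Omega> (\<lambda>x. W x \<bullet> (\<Lambda> x *\<^sub>v W x) +
        2 * (u x \<bullet> ((Isel x * mat_inv (T x))\<^sup>T *\<^sub>v (\<Sigma> x *\<^sub>v (a x - R x *\<^sub>v b x - S x *\<^sub>v G x)))))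
       \<ge> - boundary_integral \<Omega> (\<lambda>x. G x \<bullet> G x)"
    proof (rule boundary_integral_lower_bound[OF G_integrable scalar_prod_self_nonneg])
      fix x assume x: "x \<in> frontier \<Omega>"
      define r where "r = R x *\<^sub>v b x + S x *\<^sub>v G x"
      have r: "r \<in> carrier_vec (mm x)" using Rb[OF x] SG[OF x G[OF x]] by (simp add: r_def)
      have d: "a x - R x *\<^sub>v b x - S x *\<^sub>v G x = a x - r"
        unfolding r_def by (rule diff_diff_vec[OF a Rb[OF x] SG[OF x G[OF x]]])
      have dc: "a x - r \<in> carrier_vec (mm x)" using a r by simp
      have "r \<bullet> r \<le> b x \<bullet> b x + G x \<bullet> G x"
        using data_bound[OF R[OF x] conjunct1[OF S[OF x]] bspec[OF defect x] bspec[OF schur x] b G[OF x]]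
        by (simp add: r_def)
      from weak_form_lower_bound[OF a r this]
      show "- (G x \<bullet> G x) \<le> W x \<bullet> (\<Lambda> x *\<^sub>v W x) +
          2 * (u x \<bullet> ((Isel x * mat_inv (T x))\<^sup>T *\<^sub>v (\<Sigma> x *\<^sub>v (a x - R x *\<^sub>v b x - S x *\<^sub>v G x))))"
        unfolding d work[OF x bspec[OF \<Sigma> x] dc] split[OF x] .
    qed
  qed
qed

end
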